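(* For every integer $t\ge3$ there are infinitely many symplectic $t$-cores and infinitely many orthogonal $t$-cores.
   Context: A $t$-core is a partition from whose Young diagram no border strip (connected skew shape with no $2\times 2$ square) of size $t$ can be removed (equivalently, no cell has hook length divisible by $t$). A nonempty partition of rank $k$ (largest $k$ with $\lambda_k\ge k$) has Frobenius coordinates $(\alpha|\beta)$ with $\alpha_i=\lambda_i-i$, $\beta_i=\lambda'_i-i$ ($1\le i\le k$, $\lambda'$ the conjugate). A partition is symplectic if $\beta_i=\alpha_i+1$ for all $i$, and orthogonal if $\beta_i=\alpha_i-1$ for all $i$ (the empty partition is both). A symplectic (resp. orthogonal) $t$-core is a symplectic (resp. orthogonal) partition that is a $t$-core. *)

theory Defs
  imports Main
begin

text \<open>
  A partition is the weakly decreasing list of its positive parts. Parts, rows and columns are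
  indexed from 1, with \<open>part \<nu> i = 0\<close> for \<open>i = 0\<close> and for \<open>i\<close> beyond the length.
\<close>

definition is_partition :: "nat list \<Rightarrow> bool" where
  "is_partition \<nu> \<longleftrightarrow> sorted_wrt (\<ge>) \<nu> \<and> 0 \<notin> set \<nu>"

definition part :: "nat list \<Rightarrow> nat \<Rightarrow> nat" where
  "part \<nu> i = (if 1 \<le> i \<and> i \<le> length \<nu> then \<nu> ! (i - 1) else 0)"

definition young_diagram :: "nat list \<Rightarrow> (nat \<times> nat) set" where
  "young_diagram \<nu> = {(i, j). 1 \<le> i \<and> 1 \<le> j \<and> j \<le> part \<nu> i}"

definition conjugate_part :: "nat list \<Rightarrow> nat \<Rightarrow> nat" where
  "conjugate_part \<nu> j = card {i. (i, j) \<in> young_diagram \<nu>}"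

definition skew_shape :: "(nat \<times> nat) set \<Rightarrow> bool" where
  "skew_shape S \<longleftrightarrow> (\<exists>\<nu> \<mu>. is_partition \<nu> \<and> is_partition \<mu> \<and>
     young_diagram \<mu> \<subseteq> young_diagram \<nu> \<and> S = young_diagram \<nu> - young_diagram \<mu>)"

text \<open>Two cells are adjacent if they share an edge (sharing only a corner does not count).\<close>

definition adjacent_cells :: "((nat \<times> nat) \<times> (nat \<times> nat)) set" where
  "adjacent_cells = {((i, j), (i', j')).
     (i = i' \<and> (j' = Suc j \<or> j = Suc j')) \<or> (j = j' \<and> (i' = Suc i \<or> i = Suc i'))}"

definition connected_cells :: "(nat \<times> nat) set \<Rightarrow> bool" where
  "connected_cells S \<longleftrightarrow> (\<forall>x\<in>S. \<forall>y\<in>S. (x, y) \<in> (adjacent_cells \<inter> S \<times> S)\<^sup>*)"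

definition has_2x2_square :: "(nat \<times> nat) set \<Rightarrow> bool" where
  "has_2x2_square S \<longleftrightarrow> (\<exists>i j. {(i, j), (i, Suc j), (Suc i, j), (Suc i, Suc j)} \<subseteq> S)"

definition border_strip :: "(nat \<times> nat) set \<Rightarrow> bool" where
  "border_strip S \<longleftrightarrow> S \<noteq> {} \<and> skew_shape S \<and> connected_cells S \<and> \<not> has_2x2_square S"

definition t_core :: "nat \<Rightarrow> nat list \<Rightarrow> bool" where
  "t_core t \<nu> \<longleftrightarrow> is_partition \<nu> \<and>
     \<not> (\<exists>\<mu>. is_partition \<mu> \<and> young_diagram \<mu> \<subseteq> young_diagram \<nu> \<and>
          border_strip (young_diagram \<nu> - young_diagram \<mu>) \<and>
          card (young_diagram \<nu> - young_diagram \<mu>) = t)"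

text \<open>Since \<open>part \<nu> 0 = 0\<close>, the set below contains 0, and the empty partition has rank 0.\<close>

definition partition_rank :: "nat list \<Rightarrow> nat" where
  "partition_rank \<nu> = Max {k. k \<le> part \<nu> k}"

text \<open>
  The Frobenius coordinates are integers, so that \<open>\<beta>\<^sub>i = \<alpha>\<^sub>i - 1\<close> is not affected by truncated
  subtraction when \<open>\<alpha>\<^sub>i = 0\<close>.
\<close>

definition frobenius_alpha :: "nat list \<Rightarrow> nat \<Rightarrow> int" where
  "frobenius_alpha \<nu> i = int (part \<nu> i) - int i"

definition frobenius_beta :: "nat list \<Rightarrow> nat \<Rightarrow> int" where
  "frobenius_beta \<nu> i = int (conjugate_part \<nu> i) - int i"

definition symplectic_partition :: "nat list \<Rightarrow> bool" where
  "symplectic_partition \<nu> \<longleftrightarrow> is_partition \<nu> \<and>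
     (\<forall>i\<in>{1..partition_rank \<nu>}. frobenius_beta \<nu> i = frobenius_alpha \<nu> i + 1)"

definition orthogonal_partition :: "nat list \<Rightarrow> bool" where
  "orthogonal_partition \<nu> \<longleftrightarrow> is_partition \<nu> \<and>
     (\<forall>i\<in>{1..partition_rank \<nu>}. frobenius_beta \<nu> i = frobenius_alpha \<nu> i - 1)"

end

theory Submission
  imports Defs
begin

text \<open>
  Put \<open>X = {\<nu>\<^sub>i - i | i \<ge> 1}\<close>. Removing a border strip of size \<open>t\<close> replaces some \<open>x \<in> X\<close> by
  \<open>x - t \<notin> X\<close>, so \<open>\<nu>\<close> is a \<open>t\<close>-core as soon as \<open>X\<close> is closed under subtracting \<open>t\<close>. For every
  \<open>k \<ge> 1\<close> the partitions with Frobenius coordinates \<open>\<alpha>\<^sub>i = (k - i) t\<close>, \<open>\<beta>\<^sub>i = \<alpha>\<^sub>i + 1\<close>, and their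
  conjugates, have this property when \<open>t \<ge> 3\<close>.
\<close>

section \<open>Border strips and a criterion for t-cores\<close>

lemma part_antimono:
  assumes "is_partition \<nu>" "1 \<le> i" "i \<le> j"
  shows "part \<nu> j \<le> part \<nu> i"
proof (cases "i = j \<or> length \<nu> < j")
  case False
  then show ?thesis
    using assms sorted_wrt_nth_less[of "(\<ge>)" \<nu> "i - 1" "j - 1"]
    by (auto simp: part_def is_partition_def)
qed (auto simp: part_def)

lemma part_le_if_diagram_subset:
  assumes "young_diagram \<mu> \<subseteq> young_diagram \<nu>"
  shows "part \<mu> i \<le> part \<nu> i"
proof (cases "part \<mu> i = 0")
  case False
  then have "(i, part \<mu> i) \<in> young_diagram \<mu>"
    by (auto simp: young_diagram_def part_def split: if_splits)
  then show ?thesis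
    using assms by (auto simp: young_diagram_def)
qed simp

text \<open>Each move of a path of adjacent cells changes the row by at most one and, if it changes
  the row, keeps the column. The move that leaves the rows up to \<open>j\<close> supplies
  \<open>c\<close>.\<close>

lemma connected_cells_crossing:
  assumes "connected_cells S" "x \<in> S" "y \<in> S" "fst x \<le> j" "j < fst y"
  obtains c where "(j, c) \<in> S" "(Suc j, c) \<in> S"
proof -
  have "(x, y) \<in> (adjacent_cells \<inter> S \<times> S)\<^sup>*"
    using assms by (auto simp: connected_cells_def)
  then have "fst y \<le> j \<or> (\<exists>c. (j, c) \<in> S \<and> (Suc j, c) \<in> S)"
  proof (induction rule: rtrancl_induct)
    case base
    then show ?case using assms by simp
  next
    case (step y z)
    then show ?case
      by (cases y; cases z) (auto simp: adjacent_cells_def Suc_le_eq order.order_iff_strict)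
  qed
  then show thesis
    using assms that by auto
qed

text \<open>Take \<open>i\<close> and \<open>r\<close> to be the first and last row of the strip.
  Consecutive rows overlap in exactly one column, so the row lengths telescope. Over the integers,
  the conclusions place \<open>part \<mu> r - r\<close>, which is \<open>part \<nu> i - i\<close>
  lowered by the size of the strip, strictly between the values \<open>part \<nu> a - a\<close> at
  \<open>a = Suc r\<close> and \<open>a = r\<close>.\<close>

lemma border_strip_ends:
  assumes \<nu>: "is_partition \<nu>" and \<mu>: "is_partition \<mu>"
    and sub: "young_diagram \<mu> \<subseteq> young_diagram \<nu>"
    and strip: "border_strip (young_diagram \<nu> - young_diagram \<mu>)"
  obtains i r where "1 \<le> i" "i \<le> r" "r \<le> length \<nu>" "part \<mu> r < part \<nu> r"
    "part \<nu> (Suc r) \<le> part \<mu> r"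
    "part \<mu> r + i + card (young_diagram \<nu> - young_diagram \<mu>) = part \<nu> i + r"
proof -
  define S where "S = young_diagram \<nu> - young_diagram \<mu>"
  have S_iff: "(a, c) \<in> S \<longleftrightarrow> 1 \<le> a \<and> part \<mu> a < c \<and> c \<le> part \<nu> a" for a c
    by (auto simp: S_def young_diagram_def)
  have le: "part \<mu> a \<le> part \<nu> a" for a
    by (rule part_le_if_diagram_subset[OF sub])
  have con: "connected_cells S" and no_sq: "\<not> has_2x2_square S" and "S \<noteq> {}"
    using strip by (auto simp: border_strip_def S_def)
  define R where "R = fst ` S"
  have R_iff: "a \<in> R \<longleftrightarrow> 1 \<le> a \<and> part \<mu> a < part \<nu> a" for a
  proof -
    have "a \<in> R \<longleftrightarrow> (\<exists>c. (a, c) \<in> S)"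
      by (force simp: R_def)
    then show ?thesis
      by (auto simp: S_iff intro: exI[of _ "part \<nu> a"])
  qed
  have "R \<noteq> {}"
    using \<open>S \<noteq> {}\<close> by (simp add: R_def)
  have R_sub: "R \<subseteq> {1..length \<nu>}"
    by (auto simp: R_iff part_def split: if_splits)
  then have "finite R"
    by (rule finite_subset) simp
  define i r where "i = Min R" and "r = Max R"
  have iR: "i \<in> R" and rR: "r \<in> R" and bounds: "\<And>a. a \<in> R \<Longrightarrow> i \<le> a \<and> a \<le> r"
    using \<open>finite R\<close> \<open>R \<noteq> {}\<close> by (auto simp: i_def r_def)
  have i1: "1 \<le> i" and ir: "i \<le> r" and rlen: "r \<le> length \<nu>"
    using R_sub iR rR bounds by auto
  \<comment> \<open>Connectedness forces rows \<open>j\<close> and \<open>Suc j\<close> of the strip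
    to share a column; the absence of a 2x2 square forbids a second one.\<close>
  have step: "part \<nu> (Suc j) = Suc (part \<mu> j)" if "i \<le> j" "j < r" for j
  proof (rule antisym)
    obtain c where "(j, c) \<in> S" "(Suc j, c) \<in> S"
    proof -
      obtain x y where "x \<in> S" "fst x = i" "y \<in> S" "fst y = r"
        using iR rR by (auto simp: R_def)
      then show thesis
        using connected_cells_crossing[OF con] that \<open>i \<le> j\<close> \<open>j < r\<close> by metis
    qed
    then show "Suc (part \<mu> j) \<le> part \<nu> (Suc j)"
      by (auto simp: S_iff)
    show "part \<nu> (Suc j) \<le> Suc (part \<mu> j)"
    proof (rule ccontr)
      assume "\<not> part \<nu> (Suc j) \<le> Suc (part \<mu> j)"
      moreover have "part \<mu> (Suc j) \<le> part \<mu> j" "part \<nu> (Suc j) \<le> part \<nu> j"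
        using part_antimono[OF \<mu>] part_antimono[OF \<nu>] i1 \<open>i \<le> j\<close> by auto
      ultimately have "{(j, Suc (part \<mu> j)), (j, Suc (Suc (part \<mu> j))),
          (Suc j, Suc (part \<mu> j)), (Suc j, Suc (Suc (part \<mu> j)))} \<subseteq> S"
        using i1 \<open>i \<le> j\<close> by (auto simp: S_iff)
      then show False
        using no_sq by (auto simp: has_2x2_square_def)
    qed
  qed
  have "S = Sigma {i..r} (\<lambda>a. {part \<mu> a<..part \<nu> a})"
  proof -
    have "a \<in> R" if "(a, c) \<in> S" for a c
      using that by (force simp: R_def)
    then show ?thesis
      using bounds i1 by (auto simp: S_iff)
  qed
  then have card: "card S = (\<Sum>a = i..r. part \<nu> a - part \<mu> a)"
    by simp
  have telescope: "part \<mu> s + i + (\<Sum>a = i..s. part \<nu> a - part \<mu> a) = part \<nu> i + s"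
    if "i \<le> s" "s \<le> r" for s
    using that
  proof (induction s rule: dec_induct)
    case base
    then show ?case using le[of i] by simp
  next
    case (step n)
    then show ?case
      using \<open>\<And>j. i \<le> j \<Longrightarrow> j < r \<Longrightarrow> part \<nu> (Suc j) = Suc (part \<mu> j)\<close>[of n] le[of "Suc n"]
      by simp
  qed
  show thesis
  proof (rule that[OF i1 ir rlen])
    show "part \<mu> r < part \<nu> r"
      using rR by (simp add: R_iff)
    have "Suc r \<notin> R"
      using bounds by force
    then have "part \<nu> (Suc r) \<le> part \<mu> (Suc r)"
      by (simp add: R_iff)
    also have "\<dots> \<le> part \<mu> r"
      using part_antimono[OF \<mu>] i1 ir by simp
    finally show "part \<nu> (Suc r) \<le> part \<mu> r" .
    show "part \<mu> r + i + card (young_diagram \<nu> - young_diagram \<mu>) = part \<nu> i + r"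
      using telescope[OF ir] card by (simp add: S_def)
  qed
qed

text \<open>The last assumption says \<open>\<nu>\<^sub>j - j = (\<nu>\<^sub>i - i) - t\<close>, written without subtraction.\<close>

lemma t_coreI:
  assumes \<nu>: "is_partition \<nu>"
    and closed: "\<And>i. 1 \<le> i \<Longrightarrow> i \<le> length \<nu> \<Longrightarrow> \<exists>j\<ge>1. part \<nu> j + i + t = part \<nu> i + j"
  shows "t_core t \<nu>"
  unfolding t_core_def
proof (intro conjI notI)
  assume "\<exists>\<mu>. is_partition \<mu> \<and> young_diagram \<mu> \<subseteq> young_diagram \<nu> \<and>
    border_strip (young_diagram \<nu> - young_diagram \<mu>) \<and>
    card (young_diagram \<nu> - young_diagram \<mu>) = t"
  then obtain \<mu> where \<mu>: "is_partition \<mu>" "young_diagram \<mu> \<subseteq> young_diagram \<nu>"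
    "border_strip (young_diagram \<nu> - young_diagram \<mu>)"
    and card: "card (young_diagram \<nu> - young_diagram \<mu>) = t"
    by blast
  obtain i r where ir: "1 \<le> i" "i \<le> r" "r \<le> length \<nu>" "part \<mu> r < part \<nu> r"
    "part \<nu> (Suc r) \<le> part \<mu> r" "part \<mu> r + i + t = part \<nu> i + r"
    using border_strip_ends[OF \<nu> \<mu>] card by metis
  obtain j where j: "1 \<le> j" "part \<nu> j + i + t = part \<nu> i + j"
    using closed[of i] ir by auto
  show False
  \<comment> \<open>The values \<open>part \<nu> a - a\<close> strictly decrease in
    \<open>a\<close>, and the one at \<open>j\<close> equals \<open>part \<mu> r - r\<close>. It is
    too large if \<open>j \<le> r\<close> and too small if \<open>r < j\<close>.\<close>
  proof (cases "j \<le> r")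
    case True
    then show False
      using part_antimono[OF \<nu> j(1) True] ir j by linarith
  next
    case False
    then show False
      using part_antimono[OF \<nu>, of "Suc r" j] ir j by linarith
  qed
qed (rule \<nu>)

section \<open>Lists given by a row formula, and the family \<open>core_partition\<close>\<close>

lemma part_map_upt:
  assumes "1 \<le> i" "\<And>i. L < i \<Longrightarrow> f i = 0"
  shows "part (map f [1..<Suc L]) i = f i"
  using assms by (auto simp: part_def simp del: upt_Suc)

lemma is_partition_map_upt:
  assumes "\<And>i j. 1 \<le> i \<Longrightarrow> i \<le> j \<Longrightarrow> j \<le> L \<Longrightarrow> f j \<le> f i"
    and "\<And>i. 1 \<le> i \<Longrightarrow> i \<le> L \<Longrightarrow> 0 < f i"
  shows "is_partition (map f [1..<Suc L])"
  unfolding is_partition_def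
proof
  show "sorted_wrt (\<ge>) (map f [1..<Suc L])"
    using assms(1) by (auto simp: sorted_wrt_iff_nth_less simp del: upt_Suc)
  show "0 \<notin> set (map f [1..<Suc L])"
    using assms(2) by (fastforce simp del: upt_Suc)
qed

text \<open>
  Rows and columns of the partition with \<open>\<alpha>\<^sub>i = (k - i) t + e\<close> and \<open>\<beta>\<^sub>i = (k - i) t + 1 - e\<close>; it is
  symplectic for \<open>e = 0\<close> and orthogonal for \<open>e = 1\<close>. The column formula is meant for \<open>1 \<le> j \<le> k\<close>.
\<close>

definition core_row :: "nat \<Rightarrow> nat \<Rightarrow> nat \<Rightarrow> nat \<Rightarrow> nat" where
  "core_row t e k i =
     (if i \<le> k then (k - i) * t + i + e else k - (i - k + t - 3 + e) div (t - 1))"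

definition core_col :: "nat \<Rightarrow> nat \<Rightarrow> nat \<Rightarrow> nat \<Rightarrow> nat" where
  "core_col t e k j = (k - j) * t + j + 1 - e"

definition core_partition :: "nat \<Rightarrow> nat \<Rightarrow> nat \<Rightarrow> nat list" where
  "core_partition t e k = map (core_row t e k) [1..<Suc (core_col t e k 1)]"

context
  fixes t e k :: nat
  assumes t: "3 \<le> t" and e: "e \<le> 1" and k: "1 \<le> k"
begin

text \<open>In the first \<open>k\<close> rows both sides hold, because of the \<open>k\<close> by
  \<open>k\<close> square. Below it, \<open>i = k + 1 + n\<close> and \<open>k = j + m\<close> turn
  the column bound into \<open>n + e \<le> m * (t - 1)\<close>, and the quotient in
  \<open>core_row\<close> is \<open>n + e\<close> over \<open>t - 1\<close>, rounded up. The
  equivalence yields the columns and, for \<open>j = 1\<close>, the length of the partition.\<close>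

lemma core_row_ge_iff:
  assumes "1 \<le> i" "1 \<le> j" "j \<le> k"
  shows "j \<le> core_row t e k i \<longleftrightarrow> i \<le> core_col t e k j"
proof -
  obtain m where m: "k = j + m"
    using \<open>j \<le> k\<close> le_Suc_ex by blast
  obtain s where s: "t = s + 3"
    using t le_Suc_ex by (metis add.commute)
  show ?thesis
  proof (cases "i \<le> k")
    case True
    then obtain n where n: "k = i + n"
      using le_Suc_ex by blast
    have "n \<le> n * t" "m \<le> m * t"
      using t by simp_all
    moreover have "core_row t e k i = n * t + i + e" "core_col t e k j = m * t + j + 1 - e"
      using True m by (auto simp: core_row_def core_col_def n)
    ultimately have "j \<le> core_row t e k i" "i \<le> core_col t e k j"
      using m n e by linarith+
    then show ?thesis by simp
  next
    case False
    then obtain n where n: "i = k + Suc n"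
      using less_imp_Suc_add by (metis not_le add_Suc_right)
    have "j \<le> core_row t e k i \<longleftrightarrow> (n + s + 1 + e) div (s + 2) \<le> m"
      using False m n s \<open>1 \<le> j\<close> by (auto simp: core_row_def)
    also have "\<dots> \<longleftrightarrow> n + s + 1 + e < Suc m * (s + 2)"
      by (simp only: less_Suc_eq_le[symmetric]) (simp add: div_less_iff_less_mult)
    also have "\<dots> \<longleftrightarrow> i \<le> core_col t e k j"
      using m n s e by (auto simp: core_col_def algebra_simps)
    finally show ?thesis .
  qed
qed

lemma core_row_antimono:
  assumes "1 \<le> i" "i \<le> j"
  shows "core_row t e k j \<le> core_row t e k i"
proof (cases "j \<le> k")
  case True
  then obtain m n where mn: "j = i + m" "k = i + m + n"
    using assms le_Suc_ex by metis
  have "m \<le> m * t"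
    using t by auto
  then show ?thesis
    using mn by (simp add: core_row_def algebra_simps)
next
  case j: False
  show ?thesis
  proof (cases "i \<le> k")
    case True
    then obtain n where n: "k = i + n"
      using le_Suc_ex by blast
    have "n \<le> n * t"
      using t by simp
    moreover have "core_row t e k i = n * t + i + e"
      by (simp add: core_row_def n)
    ultimately have "k \<le> core_row t e k i"
      using n by linarith
    moreover have "core_row t e k j \<le> k"
      using j by (simp add: core_row_def)
    ultimately show ?thesis by simp
  next
    case False
    then show ?thesis
      using j assms by (auto simp: core_row_def intro!: diff_le_mono2 div_le_mono)
  qed
qed

text \<open>The list stops at the length of column 1; further down the row formula gives 0, in
  agreement with the default value of \<open>part\<close>.\<close>

lemma part_core_partition:
  assumes "1 \<le> i"
  shows "part (core_partition t e k) i = core_row t e k i"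
  unfolding core_partition_def
proof (rule part_map_upt[OF assms])
  fix i assume "core_col t e k 1 < i"
  then show "core_row t e k i = 0"
    using core_row_ge_iff[of i 1] k by (cases "i = 0") auto
qed

lemma is_partition_core_partition: "is_partition (core_partition t e k)"
  unfolding core_partition_def
  using core_row_antimono core_row_ge_iff[of _ 1] k
  by (intro is_partition_map_upt) (auto simp: Suc_le_eq)

lemma conjugate_part_core_partition:
  assumes "1 \<le> j" "j \<le> k"
  shows "conjugate_part (core_partition t e k) j = core_col t e k j"
proof -
  have "{i. (i, j) \<in> young_diagram (core_partition t e k)} = {1..core_col t e k j}"
    using core_row_ge_iff[OF _ assms] assms
    by (auto simp: young_diagram_def part_core_partition)
  then show ?thesis
    by (simp add: conjugate_part_def)
qed

lemma partition_rank_core_partition: "partition_rank (core_partition t e k) = k"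
proof -
  have "i \<le> k" if "i \<le> part (core_partition t e k) i" for i
  proof (rule ccontr)
    assume "\<not> i \<le> k"
    then show False
      using that part_core_partition[of i] by (simp add: core_row_def)
  qed
  moreover have "k \<le> part (core_partition t e k) k"
    using part_core_partition[OF k] by (simp add: core_row_def)
  ultimately show ?thesis
    unfolding partition_rank_def
    by (intro Max_eqI) (auto intro: finite_subset[of _ "{..k}"])
qed

text \<open>Lowering \<open>core_row t e k i - i\<close> by \<open>t\<close> leads to row
  \<open>i + 1\<close> if \<open>i < k\<close>, to row \<open>k + t - 1 - e\<close> if
  \<open>i = k\<close>, and to row \<open>i + t - 1\<close> if \<open>k < i\<close>.\<close>

lemma t_core_core_partition: "t_core t (core_partition t e k)"
proof (rule t_coreI[OF is_partition_core_partition])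
  fix i assume i: "1 \<le> i" "i \<le> length (core_partition t e k)"
  obtain s where s: "t = s + 3"
    using t le_Suc_ex by (metis add.commute)
  have "\<exists>j\<ge>1. core_row t e k j + i + t = core_row t e k i + j"
  proof -
    consider "i < k" | "i = k" | "k < i" by linarith
    then show ?thesis
    proof cases
      case 1
      then obtain n where "k = Suc i + n"
        using less_imp_Suc_add by auto
      then show ?thesis
        by (intro exI[of _ "Suc i"]) (simp add: core_row_def algebra_simps)
    next
      case 2
      \<comment> \<open>In row \<open>k + t - 1 - e\<close> the dividend of \<open>core_row\<close>
        is \<open>2 * t - 4\<close>. As \<open>t \<ge> 3\<close>, it is at least the divisor
        \<open>t - 1\<close> and less than twice it.\<close>
      have "(s + s + 2) div (s + 2) = 1"
        by (rule div_nat_eqI) auto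
      then have "core_row t e k (k + t - 1 - e) = k - 1"
        using s e by (auto simp: core_row_def le_Suc_eq)
      moreover have "core_row t e k i = k + e"
        using 2 by (simp add: core_row_def)
      ultimately show ?thesis
        using 2 s e k by (intro exI[of _ "k + t - 1 - e"]) linarith
    next
      case 3
      \<comment> \<open>Row \<open>i\<close> meets column 1, so taking 1 from its length is not
        truncated.\<close>
      have "1 \<le> core_row t e k i"
        using core_row_ge_iff[of i 1] i k by (simp add: core_partition_def del: upt_Suc)
      moreover have "core_row t e k (i + t - 1) = core_row t e k i - 1"
      proof -
        obtain n where n: "i = k + Suc n"
          using 3 less_imp_Suc_add by (metis add_Suc_right)
        \<comment> \<open>Moving down by \<open>t - 1\<close> rows adds the divisor to the dividend,
          so exactly one column is lost.\<close>
        have "(n + s + 1 + e + (s + 2)) div (s + 2) = Suc ((n + s + 1 + e) div (s + 2))"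
          by (subst div_add_self2) auto
        then show ?thesis
          using s n by (simp add: core_row_def add_ac mult_2 numeral_3_eq_3)
      qed
      ultimately show ?thesis
        using 3 s by (intro exI[of _ "i + t - 1"]) auto
    qed
  qed
  then show "\<exists>j\<ge>1. part (core_partition t e k) j + i + t = part (core_partition t e k) i + j"
    using i part_core_partition by auto
qed

lemma frobenius_core_partition:
  assumes "i \<in> {1..partition_rank (core_partition t e k)}"
  shows "frobenius_alpha (core_partition t e k) i = int ((k - i) * t) + int e"
    and "frobenius_beta (core_partition t e k) i = int ((k - i) * t) + 1 - int e"
  using assms e
  by (auto simp: partition_rank_core_partition frobenius_alpha_def frobenius_beta_def
      part_core_partition conjugate_part_core_partition core_row_def core_col_def)

end

text \<open>The rank of \<open>core_partition t e k\<close> is \<open>k\<close>, so a finite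
  \<open>A\<close> would leave only finitely many ranks.\<close>

lemma infinite_if_core_partitions:
  assumes "3 \<le> t" "e \<le> 1" "\<And>k. 1 \<le> k \<Longrightarrow> core_partition t e k \<in> A"
  shows "infinite A"
proof
  assume "finite A"
  then have "finite (partition_rank ` core_partition t e ` {1..})"
    using assms(3) by (auto intro: finite_subset[of _ A])
  moreover have "partition_rank ` core_partition t e ` {1..} = {1..}"
    using partition_rank_core_partition[OF assms(1,2)] by (force simp: image_iff)
  ultimately show False
    using infinite_Ici by metis
qed

theorem theorem2p21:
  fixes t :: nat
  assumes "t \<ge> 3"
  shows "infinite {\<nu>. symplectic_partition \<nu> \<and> t_core t \<nu>} \<and>
         infinite {\<nu>. orthogonal_partition \<nu> \<and> t_core t \<nu>}"
proof
  show "infinite {\<nu>. symplectic_partition \<nu> \<and> t_core t \<nu>}"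
    using assms
    by (intro infinite_if_core_partitions[of t 0])
      (simp_all add: symplectic_partition_def is_partition_core_partition t_core_core_partition
        frobenius_core_partition)
  show "infinite {\<nu>. orthogonal_partition \<nu> \<and> t_core t \<nu>}"
    using assms
    by (intro infinite_if_core_partitions[of t 1])
      (simp_all add: orthogonal_partition_def is_partition_core_partition t_core_core_partition
        frobenius_core_partition)
qed

end
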